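(* Let $T\colon[0,1]\to[0,1]$ be measurable and let $\mu$ be a $T$-invariant Borel probability measure on $[0,1]$ such that $([0,1],T,\mu)$ is exponentially mixing for bounded variation against $L^1$. Suppose that $y\in\operatorname{supp}\mu$ is a point for which there are constants $c_1,r_0>0$ such that $$B(y,r)\cap T^kB(y,r)=\emptyset$$ for all integers $1\le k\le -c_1\log r$ and all $0<r<r_0$. Then for every $t>0$ and every integer $p\ge0$, $$\lim_{r\to0}\mu\bigl\{\,x: p=\#\{\,1\le j\le t/\mu(B(y,r)):T^j(x)\in B(y,r)\,\}\,\bigr\}=\frac{t^pe^{-t}}{p!}.$$
   Context: $B(y,r)$ denotes the ball in $[0,1]$ with centre $y$ and radius $r$; $j$ and $k$ range over integers. The system $([0,1],T,\mu)$ is exponentially mixing for bounded variation against $L^1$ if there are constants $\tau,\tilde C>0$ such that $$\Bigl|\int f\circ T^n\, g\,\mathrm d\mu-\int f\,\mathrm d\mu\int g\,\mathrm d\mu\Bigr|\le\tilde C e^{-\tau n}\lVert f\rVert_{L^1}\lVert g\rVert_{BV}$$ for all $n$ and all functions $f,g$ with $\lVert f\rVert_{L^1}<\infty$ (the $L^1(\mu)$ norm) and $\lVert g\rVert_{BV}<\infty$ (the usual bounded variation norm on $[0,1]$, e.g. supremum norm plus total variation). *)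

theory Defs
  imports "HOL-Probability.Probability"
begin

definition unit_ball :: "real \<Rightarrow> real \<Rightarrow> real set" where
  "unit_ball y r = ball y r \<inter> {0..1}"

definition measure_support :: "'a::topological_space measure \<Rightarrow> 'a set" where
  "measure_support M =
     {x \<in> space M. \<forall>U. open U \<longrightarrow> x \<in> U \<longrightarrow> emeasure M (U \<inter> space M) > 0}"

text \<open>A partition of the interval is encoded as the sorted list of its points. Lists that
  omit the end points or repeat points do not change the supremum. The value is infinite
  exactly for functions of unbounded variation.\<close>

definition total_variation :: "real \<Rightarrow> real \<Rightarrow> (real \<Rightarrow> real) \<Rightarrow> ennreal" where
  "total_variation a b g =
     (SUP xs\<in>{xs. sorted xs \<and> set xs \<subseteq> {a..b}}.
        \<Sum>i<length xs - 1. ennreal \<bar>g (xs ! Suc i) - g (xs ! i)\<bar>)"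

definition bv_norm :: "(real \<Rightarrow> real) \<Rightarrow> ennreal" where
  "bv_norm g = (SUP x\<in>{0..1}. ennreal \<bar>g x\<bar>) + total_variation 0 1 g"

text \<open>The measure is meant to live on the Borel sets of the unit interval. A function with
  finite \<^const>\<open>bv_norm\<close> is then automatically bounded and measurable, so only the
  integrability of \<open>f\<close> has to be required.\<close>

definition exp_mixing_BV_L1 :: "real measure \<Rightarrow> (real \<Rightarrow> real) \<Rightarrow> bool" where
  "exp_mixing_BV_L1 M T \<longleftrightarrow>
     (\<exists>\<tau>>0. \<exists>C>0. \<forall>(n::nat) f g. integrable M f \<longrightarrow> bv_norm g < \<infinity> \<longrightarrow>
        \<bar>(\<integral>x. f ((T ^^ n) x) * g x \<partial>M) - (\<integral>x. f x \<partial>M) * (\<integral>x. g x \<partial>M)\<bar>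
          \<le> C * exp (- \<tau> * real n) * (\<integral>x. \<bar>f x\<bar> \<partial>M) * enn2real (bv_norm g))"

end

theory Submission
  imports Defs
begin

text \<open>The law of the number of visits to \<open>A = B(y, r)\<close> is determined by its binomial moments, the
  sums over \<open>q\<close>-element sets of times of the probability to be in \<open>A\<close> at all these times.
  The indicator of \<open>A\<close> has variation norm at most 3, while the function against which one mixes
  only enters through its \<open>L\<^sup>1\<close> norm. So the first visit can be split off any configuration of
  later visits, with an error proportional to the measure of that configuration. The sum of these
  errors over the gap \<open>n\<close> to the next visit tends to 0: the mixing error is exponentially small
  for \<open>n > K = -c\<^sub>1 ln r\<close>, and for \<open>n \<le> K\<close> there are no returns, while mixing at time \<open>K\<close> bounds
  the measure of \<open>A\<close> itself exponentially in \<open>K\<close>. Hence the binomial moments are asymptotically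
  those of the binomial distribution, and the Bonferroni inequalities give the Poisson limit.\<close>

section \<open>Variation norm of the indicator of a ball\<close>

lemma sum_abs_diff_mono_sorted_le_1:
  fixes u :: "real \<Rightarrow> real"
  assumes "sorted xs" "mono u" "\<And>x. 0 \<le> u x" "\<And>x. u x \<le> 1"
  shows "(\<Sum>i<length xs - 1. \<bar>u (xs ! Suc i) - u (xs ! i)\<bar>) \<le> 1"
proof -
  have "(\<Sum>i<length xs - 1. \<bar>u (xs ! Suc i) - u (xs ! i)\<bar>)
      = (\<Sum>i<length xs - 1. u (xs ! Suc i) - u (xs ! i))"
  proof (rule sum.cong)
    fix i assume "i \<in> {..<length xs - 1}"
    then have "xs ! i \<le> xs ! Suc i"
      using assms(1) by (intro sorted_nth_mono) auto
    then show "\<bar>u (xs ! Suc i) - u (xs ! i)\<bar> = u (xs ! Suc i) - u (xs ! i)"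
      using monoD[OF assms(2)] by simp
  qed simp
  also have "\<dots> = u (xs ! (length xs - 1)) - u (xs ! 0)"
    by (rule sum_lessThan_telescope)
  also have "\<dots> \<le> 1"
    using assms(3)[of "xs ! 0"] assms(4)[of "xs ! (length xs - 1)"] by linarith
  finally show ?thesis .
qed

text \<open>The supremum contributes 1, and each of the two end points of the ball contributes at
  most one unit jump to the variation.\<close>

lemma bv_norm_indicator_unit_ball: "bv_norm (indicator (unit_ball y r)) \<le> 3"
proof -
  let ?g = "indicator (unit_ball y r) :: real \<Rightarrow> real"
  let ?u = "\<lambda>x::real. of_bool (x > y - r) :: real"
  let ?v = "\<lambda>x::real. of_bool (x \<ge> y + r) :: real"
  \<comment> \<open>For \<open>r > 0\<close> the indicator is \<open>?u - ?v\<close> on the unit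
    interval; for \<open>r <= 0\<close> the ball is empty and the left side is 0.\<close>
  have g: "\<bar>?g b - ?g a\<bar> \<le> \<bar>?u b - ?u a\<bar> + \<bar>?v b - ?v a\<bar>"
    if "a \<in> {0..1}" "b \<in> {0..1}" for a b
    using that by (auto simp: unit_ball_def indicator_def dist_real_def split: if_splits)
  have "(\<Sum>i<length xs - 1. ennreal \<bar>?g (xs ! Suc i) - ?g (xs ! i)\<bar>) \<le> 2"
    if "sorted xs" "set xs \<subseteq> {0..1}" for xs
  proof -
    have "(\<Sum>i<length xs - 1. \<bar>?g (xs ! Suc i) - ?g (xs ! i)\<bar>)
        \<le> (\<Sum>i<length xs - 1. \<bar>?u (xs ! Suc i) - ?u (xs ! i)\<bar> + \<bar>?v (xs ! Suc i) - ?v (xs ! i)\<bar>)"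
      by (intro sum_mono g) (use that(2) nth_mem in \<open>force+\<close>)
    also have "\<dots> \<le> 1 + 1"
      unfolding sum.distrib
      by (intro add_mono sum_abs_diff_mono_sorted_le_1 that(1)) (auto intro!: monoI)
    finally show ?thesis
      by (simp add: sum_ennreal ennreal_leI flip: ennreal_numeral)
  qed
  then have "total_variation 0 1 ?g \<le> 2"
    unfolding total_variation_def by (intro SUP_least) auto
  moreover have "(SUP x\<in>{0..1}. ennreal \<bar>?g x\<bar>) \<le> 1"
    by (intro SUP_least) (auto simp: indicator_def)
  ultimately have "bv_norm ?g \<le> 1 + 2"
    unfolding bv_norm_def by (rule add_mono[rotated])
  then show ?thesis by simp
qed

section \<open>Bonferroni inequalities and binomial moments\<close>

text \<open>For \<open>n > 0\<close> the alternating sum up to \<open>k\<close> collapses to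
  \<open>(-1)^k\<close> times the binomial of \<open>n - 1\<close> over \<open>k\<close>, which
  Pascal's rule bounds by that of \<open>n\<close> over \<open>k + 1\<close>.\<close>

lemma alternating_binomial_sum_bound:
  "\<bar>of_bool (n = 0) - (\<Sum>i\<le>k. (-1) ^ i * real (n choose i))\<bar> \<le> real (n choose Suc k)"
proof (cases n)
  case 0
  have "(\<Sum>i\<le>k. (-1) ^ i * real (0 choose i)) = (\<Sum>i\<le>k. if i = 0 then 1 else 0)"
    by (intro sum.cong) (auto simp: binomial_eq_0)
  then show ?thesis using 0 by simp
next
  case (Suc n')
  have "(\<Sum>i\<le>k. (-1) ^ i * real (n choose i)) = (\<Sum>i\<le>k. (real n gchoose i) * (-1) ^ i)"
    by (simp add: binomial_gbinomial mult.commute)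
  also have "\<dots> = (-1) ^ k * (real n - 1 gchoose k)"
    by (rule gbinomial_sum_lower_neg)
  also have "real n - 1 gchoose k = real (n' choose k)"
    using Suc by (simp add: binomial_gbinomial)
  finally show ?thesis
    using Suc by (simp add: abs_mult)
qed

text \<open>Bonferroni inequality for exactly \<open>p\<close> out of \<open>n\<close> events. The
  product of the two binomials is (\<open>n\<close> over \<open>p\<close>) times
  (\<open>n - p\<close> over \<open>i\<close>), so the common factor comes out and the case of no
  event among \<open>n - p\<close> remains.\<close>

lemma binomial_inversion_bound:
  fixes n p k :: nat
  shows "\<bar>of_bool (n = p)
      - (\<Sum>i\<le>k. (-1) ^ i * real ((p + i) choose p) * real (n choose (p + i)))\<bar>
    \<le> real ((p + Suc k) choose p) * real (n choose (p + Suc k))"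
proof (cases "p \<le> n")
  case False
  then show ?thesis by (simp add: binomial_eq_0)
next
  case True
  have split: "real ((p + i) choose p) * real (n choose (p + i))
      = real (n choose p) * real ((n - p) choose i)" for i
  proof (cases "p + i \<le> n")
    case True
    have "(n choose (p + i)) * ((p + i) choose p) = (n choose p) * ((n - p) choose i)"
      using choose_mult[of p "p + i" n] True by simp
    then show ?thesis by (metis mult.commute of_nat_mult)
  next
    case False
    then show ?thesis using True by (simp add: binomial_eq_0)
  qed
  have "of_bool (n = p) = real (n choose p) * of_bool (n - p = 0)"
    using True by auto
  then have "of_bool (n = p)
      - (\<Sum>i\<le>k. (-1) ^ i * real ((p + i) choose p) * real (n choose (p + i)))
      = real (n choose p)
        * (of_bool (n - p = 0) - (\<Sum>i\<le>k. (-1) ^ i * real ((n - p) choose i)))"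
    by (simp only: split mult.assoc right_diff_distrib sum_distrib_left mult.left_commute)
  then show ?thesis
    using mult_left_mono[OF alternating_binomial_sum_bound[of "n - p" k], of "real (n choose p)"]
    by (simp only: split abs_mult abs_of_nat of_nat_0_le_iff)
qed

text \<open>The limits of the truncated sums are \<open>t^p / p!\<close> times the Taylor sums of
  \<open>exp (- t)\<close>, and the limit of the error bound is \<open>t^p / p!\<close> times a term
  of the exponential series.\<close>

lemma poisson_limit_of_binomial_moments:
  fixes P :: "'r \<Rightarrow> real" and B :: "nat \<Rightarrow> 'r \<Rightarrow> real" and t :: real
  assumes B: "\<And>q. ((B q) \<longlongrightarrow> t ^ q / fact q) F"
    and bound: "\<And>k. \<forall>\<^sub>F r in F.
      \<bar>P r - (\<Sum>i\<le>k. (-1) ^ i * real ((p + i) choose p) * B (p + i) r)\<bar>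
        \<le> real ((p + Suc k) choose p) * B (p + Suc k) r"
  shows "(P \<longlongrightarrow> t ^ p * exp (- t) / fact p) F"
proof (rule tendstoI)
  fix \<epsilon> :: real assume "\<epsilon> > 0"
  define c where "c = t ^ p / fact p"
  define S where "S k = (\<Sum>i\<le>k. (- t) ^ i / fact i)" for k
  have split: "real ((p + i) choose p) * (t ^ (p + i) / fact (p + i)) = c * (t ^ i / fact i)" for i
    by (simp add: c_def binomial_fact power_add)
  have "(\<lambda>i. (- t) ^ i / fact i) sums exp (- t)"
    using exp_converges[of "- t"] by (simp add: field_simps scaleR_conv_of_real)
  then have "S \<longlonglongrightarrow> exp (- t)"
    unfolding S_def sums_def_le .
  then have "(\<lambda>k. c * S k) \<longlonglongrightarrow> c * exp (- t)"
    by (intro tendsto_intros)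
  then have S: "\<forall>\<^sub>F k in sequentially. dist (c * S k) (c * exp (- t)) < \<epsilon> / 3"
    by (rule tendstoD) (use \<open>\<epsilon> > 0\<close> in simp)
  have "(\<lambda>k. t ^ k / fact k) \<longlonglongrightarrow> 0"
    using summable_LIMSEQ_zero[OF summable_exp[of t]] by (simp add: field_simps)
  then have "(\<lambda>k. c * (t ^ Suc k / fact (Suc k))) \<longlonglongrightarrow> c * 0"
    by (intro tendsto_intros) (rule LIMSEQ_Suc)
  then have R: "\<forall>\<^sub>F k in sequentially. c * (t ^ Suc k / fact (Suc k)) < \<epsilon> / 3"
    by (rule order_tendstoD) (use \<open>\<epsilon> > 0\<close> in simp)
  \<comment> \<open>The truncation \<open>k\<close> is fixed before \<open>r\<close> varies, so only
    finitely many moments enter and no uniformity in \<open>q\<close> is needed.\<close>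
  obtain k where k: "dist (c * S k) (c * exp (- t)) < \<epsilon> / 3"
      "c * (t ^ Suc k / fact (Suc k)) < \<epsilon> / 3"
    using eventually_happens[OF eventually_conj[OF S R]] by auto
  let ?X = "\<lambda>r. \<Sum>i\<le>k. (-1) ^ i * real ((p + i) choose p) * B (p + i) r"
  have "(?X \<longlongrightarrow> (\<Sum>i\<le>k. (-1) ^ i * real ((p + i) choose p) * (t ^ (p + i) / fact (p + i)))) F"
    by (intro tendsto_intros B)
  also have "(\<Sum>i\<le>k. (-1) ^ i * real ((p + i) choose p) * (t ^ (p + i) / fact (p + i))) = c * S k"
    unfolding S_def sum_distrib_left mult.assoc split
    by (intro sum.cong refl) (simp add: power_minus[of t])
  finally have X: "\<forall>\<^sub>F r in F. dist (?X r) (c * S k) < \<epsilon> / 3"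
    by (rule tendstoD) (use \<open>\<epsilon> > 0\<close> in simp)
  have "((\<lambda>r. real ((p + Suc k) choose p) * B (p + Suc k) r)
      \<longlongrightarrow> real ((p + Suc k) choose p) * (t ^ (p + Suc k) / fact (p + Suc k))) F"
    by (intro tendsto_intros B)
  then have "\<forall>\<^sub>F r in F. real ((p + Suc k) choose p) * B (p + Suc k) r < \<epsilon> / 3"
    by (rule order_tendstoD) (use k(2) in \<open>simp only: split\<close>)
  with X bound[of k] show "\<forall>\<^sub>F r in F. dist (P r) (t ^ p * exp (- t) / fact p) < \<epsilon>"
  proof eventually_elim
    case (elim r)
    moreover have "t ^ p * exp (- t) / fact p = c * exp (- t)"
      by (simp add: c_def)
    ultimately show ?case
      using k(1) unfolding dist_real_def by linarith
  qed
qed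

text \<open>Spreading \<open>m^q\<close> over the \<open>q\<close> factors of the falling factorial
  makes each factor \<open>N m - i m\<close> converge to \<open>t\<close>.\<close>

lemma binomial_moment_limit:
  fixes m :: "'r \<Rightarrow> real" and N :: "'r \<Rightarrow> nat"
  assumes m: "(m \<longlongrightarrow> 0) F" and Nm: "((\<lambda>r. real (N r) * m r) \<longlongrightarrow> t) F"
  shows "((\<lambda>r. m r ^ q * real (N r choose q)) \<longlongrightarrow> t ^ q / fact q) F"
proof -
  have eq: "m r ^ q * real (N r choose q) = (\<Prod>i<q. real (N r) * m r - real i * m r) / fact q" for r
  proof -
    have "real (N r choose q) = (\<Prod>i<q. real (N r) - real i) / fact q"
      by (simp add: binomial_gbinomial gbinomial_prod_rev lessThan_atLeast0)
    moreover have "m r ^ q * (\<Prod>i<q. real (N r) - real i) = (\<Prod>i<q. real (N r) * m r - real i * m r)"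
      by (induction q) (simp_all add: algebra_simps)
    ultimately show ?thesis by simp
  qed
  have "((\<lambda>r. (\<Prod>i<q. real (N r) * m r - real i * m r) / fact q)
      \<longlongrightarrow> (\<Prod>i<q. t - real i * 0) / fact q) F"
    by (intro tendsto_intros m Nm) simp
  then show ?thesis by (simp add: eq)
qed

section \<open>Visits to a set with few short returns\<close>

definition visits :: "('a \<Rightarrow> 'a) \<Rightarrow> 'a set \<Rightarrow> nat \<Rightarrow> 'a \<Rightarrow> nat" where
  "visits T A L x = (\<Sum>j<L. of_bool ((T ^^ Suc j) x \<in> A))"

lemma visits_0 [simp]: "visits T A 0 x = 0"
  by (simp add: visits_def)

lemma visits_Suc: "visits T A (Suc L) x = of_bool (T x \<in> A) + visits T A L (T x)"
  by (simp add: visits_def sum.lessThan_Suc_shift funpow_swap1 del: sum.lessThan_Suc)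

lemma visits_eq_card: "visits T A L x = card {j. 1 \<le> j \<and> j \<le> L \<and> (T ^^ j) x \<in> A}"
proof -
  have "visits T A L x = card {j \<in> {..<L}. (T ^^ Suc j) x \<in> A}"
    by (simp add: visits_def of_bool_def sum.If_cases Int_def del: funpow.simps)
  also have "\<dots> = card (Suc ` {j \<in> {..<L}. (T ^^ Suc j) x \<in> A})"
    by (simp add: card_image)
  also have "Suc ` {j \<in> {..<L}. (T ^^ Suc j) x \<in> A} = {j. 1 \<le> j \<and> j \<le> L \<and> (T ^^ j) x \<in> A}"
  proof (intro set_eqI iffI)
    fix j assume j: "j \<in> {j. 1 \<le> j \<and> j \<le> L \<and> (T ^^ j) x \<in> A}"
    then obtain i where "j = Suc i"
      by (cases j) auto
    with j show "j \<in> Suc ` {j \<in> {..<L}. (T ^^ Suc j) x \<in> A}"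
      by auto
  qed (auto simp del: funpow.simps)
  finally show ?thesis .
qed

lemma visits_le: "visits T A L x \<le> L"
  unfolding visits_def by (rule order_trans[OF sum_bounded_above[of _ _ 1]]) auto

text \<open>A crude bound that serves for integrability.\<close>

lemma visits_choose_le: "visits T A L x choose q \<le> 2 ^ L"
proof -
  have "visits T A L x choose q \<le> 2 ^ visits T A L x"
    by (rule binomial_le_pow2)
  also have "\<dots> \<le> 2 ^ L"
    by (intro power_increasing visits_le) simp
  finally show ?thesis .
qed

text \<open>Sorts the \<open>q + 1\<close> element sets of visiting times by their first element.\<close>

lemma visits_choose_Suc:
  "real (visits T A L x choose Suc q)
    = (\<Sum>n<L. indicator A ((T ^^ Suc n) x) * real (visits T A (L - Suc n) ((T ^^ Suc n) x) choose q))"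
proof (induction L arbitrary: x)
  case (Suc L)
  have "real (visits T A (Suc L) x choose Suc q)
      = indicator A (T x) * real (visits T A L (T x) choose q) + real (visits T A L (T x) choose Suc q)"
    by (simp add: visits_Suc indicator_def)
  also have "real (visits T A L (T x) choose Suc q) = (\<Sum>n<L. indicator A ((T ^^ Suc n) (T x))
      * real (visits T A (L - Suc n) ((T ^^ Suc n) (T x)) choose q))"
    by (rule Suc.IH)
  finally show ?case
    by (simp add: sum.lessThan_Suc_shift funpow_swap1 del: sum.lessThan_Suc)
qed simp

section \<open>The total error over all gaps\<close>

lemma geometric_tail_sum_le:
  fixes x :: real
  assumes "0 \<le> x" "x < 1"
  shows "(\<Sum>n<L. if n < K then 0 else x ^ Suc n) \<le> x ^ K / (1 - x)"
proof -
  \<comment> \<open>The terms telescope; \<open>max K L\<close> makes the right side vanish while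
    \<open>L <= K\<close>, when the sum is still empty.\<close>
  have "(\<Sum>n<L. if n < K then 0 else x ^ Suc n) * (1 - x) \<le> x ^ Suc K - x ^ Suc (max K L)"
  proof (induction L)
    case (Suc L)
    then show ?case
      using assms by (cases "L < K") (auto simp: max_def algebra_simps not_less dest: le_antisym)
  qed simp
  also have "\<dots> \<le> x ^ K"
  proof -
    have "x ^ Suc K \<le> x ^ K"
      using assms by (intro power_decreasing) auto
    moreover have "0 \<le> x ^ Suc (max K L)"
      using assms by (intro zero_le_power)
    ultimately show ?thesis by linarith
  qed
  finally show ?thesis
    using assms by (simp add: field_simps)
qed

text \<open>Bounds the sum over all gaps \<open>n \<ge> 1\<close> of the mixing error of two visits at distance \<open>n\<close>,
  relative to the later visit: for \<open>n \<le> K\<close> the error is \<open>measure M A \<le> D * x ^ K\<close>, because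
  there are no returns, and for \<open>n > K\<close> it is \<open>D * x ^ n\<close>.\<close>

definition gap_error :: "real \<Rightarrow> real \<Rightarrow> nat \<Rightarrow> real" where
  "gap_error D x K = D * (real K * x ^ K) + D / (1 - x) * x ^ K"

lemma gap_error_tendsto_0:
  assumes "0 < x" "x < 1"
  shows "(gap_error D x \<longlongrightarrow> 0) sequentially"
proof -
  have "(\<lambda>K. D * (real K * x ^ K) + D / (1 - x) * x ^ K) \<longlonglongrightarrow> D * 0 + D / (1 - x) * 0"
    using assms by (intro tendsto_intros powser_times_n_limit_0 LIMSEQ_power_zero) auto
  then show ?thesis
    by (simp add: gap_error_def [abs_def])
qed

lemma sum_choose_lessThan: "(\<Sum>l<L. real (l choose q)) = real (L choose Suc q)"
  by (induction L) auto

section \<open>Binomial moments of the visits to one fixed set\<close>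

text \<open>The situation at one radius. Its estimates are explicit in \<open>D\<close>,
  \<open>x\<close> and \<open>K\<close>; as the radius shrinks, \<open>D\<close> and
  \<open>x\<close> stay fixed and only \<open>K\<close> grows. The later observable \<open>f\<close>
  enters through its \<open>L^1\<close> norm alone, which makes every error proportional to the
  measure of the later configuration.\<close>

locale sparse_returns = prob_space M for M :: "'a measure" +
  fixes T :: "'a \<Rightarrow> 'a" and A :: "'a set" and D x :: real and K :: nat
  assumes T [measurable]: "T \<in> measurable M M"
    and invariant: "distr M M T = M"
    and A [measurable]: "A \<in> sets M"
    and D: "0 \<le> D" and x: "0 < x" "x < 1"
    and mixing: "\<And>n f. integrable M f \<Longrightarrow>
      \<bar>(\<integral>z. indicator A z * f ((T ^^ n) z) \<partial>M) - measure M A * (\<integral>z. f z \<partial>M)\<bar>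
        \<le> D * x ^ n * (\<integral>z. \<bar>f z\<bar> \<partial>M)"
    and no_return: "\<And>n z. z \<in> A \<Longrightarrow> 1 \<le> n \<Longrightarrow> n \<le> K \<Longrightarrow> (T ^^ n) z \<notin> A"
    and K: "1 \<le> K"
    and measure_pos: "0 < measure M A"
begin

abbreviation "m \<equiv> measure M A"

lemma measurable_funpow [measurable]: "T ^^ n \<in> measurable M M"
proof (induction n)
  case (Suc n)
  then show ?case
    by (simp add: measurable_comp[OF _ T])
qed (simp add: id_def)

lemma integral_funpow:
  fixes f :: "'a \<Rightarrow> real"
  assumes [measurable]: "f \<in> borel_measurable M"
  shows "(\<integral>z. f ((T ^^ n) z) \<partial>M) = (\<integral>z. f z \<partial>M)"
  using assms
proof (induction n arbitrary: f)
  case (Suc n)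
  note Suc.prems[measurable]
  have "(\<integral>z. f ((T ^^ Suc n) z) \<partial>M) = (\<integral>z. f (T ((T ^^ n) z)) \<partial>M)"
    by simp
  also have "\<dots> = (\<integral>z. f (T z) \<partial>M)"
    using Suc.IH[of "\<lambda>z. f (T z)"] by simp
  also have "\<dots> = (\<integral>z. f z \<partial>distr M M T)"
    by (rule integral_distr[symmetric]) auto
  finally show ?case by (simp add: invariant)
qed simp

lemma measurable_visits [measurable]: "visits T A L \<in> measurable M (count_space UNIV)"
  unfolding visits_def by measurable

text \<open>The integral \<open>G q L\<close> weighs configurations of \<open>q + 1\<close> visits,
  the first of them at time 0. Splitting off that visit gives a recursion in
  \<open>q\<close>.\<close>

definition "mark q L z = indicator A z * real (visits T A L z choose q)"

definition "G q L = (\<integral>z. mark q L z \<partial>M)"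

abbreviation "B q L \<equiv> (\<integral>z. real (visits T A L z choose q) \<partial>M)"

lemma integrable_visits_choose: "integrable M (\<lambda>z. real (visits T A L z choose q))"
  by (rule integrable_const_bound[where B = "2 ^ L"]) (auto simp: visits_choose_le)

lemma measurable_mark [measurable]: "mark q L \<in> borel_measurable M"
  unfolding mark_def by measurable

lemma integrable_mark_funpow: "integrable M (\<lambda>z. mark q L ((T ^^ n) z))"
proof (rule integrable_const_bound[where B = "2 ^ L"])
  show "AE z in M. norm (mark q L ((T ^^ n) z)) \<le> 2 ^ L"
    by (intro AE_I2) (auto simp: mark_def indicator_def visits_choose_le)
qed measurable

lemma integrable_mark: "integrable M (mark q L)"
  using integrable_mark_funpow[of q L 0] by simp

lemma integrable_indicator_mark:
  "integrable M (\<lambda>z. indicator A z * mark q L ((T ^^ n) z))"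
  using integrable_mult_indicator[OF A integrable_mark_funpow] by simp

lemma mark_nonneg: "0 \<le> mark q L z"
  by (simp add: mark_def)

lemma G_nonneg: "0 \<le> G q L"
  unfolding G_def by (intro integral_nonneg_AE AE_I2 mark_nonneg)

lemma no_return_indicator:
  "1 \<le> n \<Longrightarrow> n \<le> K \<Longrightarrow> indicator A z * (indicator A ((T ^^ n) z) * c) = (0 :: real)"
  using no_return[of z n] by (auto simp: indicator_def)

text \<open>Mixing of \<open>A\<close> with itself at time \<open>K\<close>: the correlation is 0
  for lack of returns, so \<open>m * m <= D * x^K * m\<close>, and \<open>m > 0\<close>
  cancels.\<close>

lemma measure_le: "m \<le> D * x ^ K"
proof -
  have "indicator A z * indicator A ((T ^^ K) z) = (0 :: real)" for z
    using no_return_indicator[of K z 1] K by simp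
  then have "(\<integral>z. indicator A z * indicator A ((T ^^ K) z) \<partial>M) = (0 :: real)"
    by (simp only: Bochner_Integration.integral_zero)
  then have "m * m \<le> D * x ^ K * m"
    using mixing[of "indicator A" K] by (simp add: integrable_indicator_iff emeasure_eq_measure)
  then show ?thesis
    using measure_pos by simp
qed

text \<open>For \<open>n <= K\<close> the correlation vanishes and the error is the product
  \<open>m * G q L\<close> itself. For larger \<open>n\<close> mixing applies, and the
  \<open>L^1\<close> norm of the nonnegative \<open>mark\<close> is \<open>G q L\<close>.\<close>

lemma mixing_mark:
  assumes "1 \<le> n"
  shows "\<bar>(\<integral>z. indicator A z * mark q L ((T ^^ n) z) \<partial>M) - m * G q L\<bar>
    \<le> (if n \<le> K then m else D * x ^ n) * G q L"
proof (cases "n \<le> K")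
  case True
  then have "indicator A z * mark q L ((T ^^ n) z) = 0" for z
    unfolding mark_def using assms by (intro no_return_indicator)
  then have "(\<integral>z. indicator A z * mark q L ((T ^^ n) z) \<partial>M) = 0"
    by (simp only: Bochner_Integration.integral_zero)
  then show ?thesis
    using True G_nonneg[of q L] by (simp add: abs_mult)
next
  case False
  then show ?thesis
    using mixing[OF integrable_mark[of q L], of n] by (simp add: G_def abs_of_nonneg mark_nonneg)
qed

lemma sum_gap_errors_le:
  "(\<Sum>n<L. if Suc n \<le> K then m else D * x ^ Suc n) \<le> gap_error D x K"
proof -
  have "(\<Sum>n<L. if Suc n \<le> K then m else D * x ^ Suc n)
      = (\<Sum>n<L. if n < K then m else 0) + D * (\<Sum>n<L. if n < K then 0 else x ^ Suc n)"
    unfolding sum_distrib_left sum.distrib[symmetric] by (intro sum.cong) auto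
  moreover have "(\<Sum>n<L. if n < K then m else 0) \<le> D * (real K * x ^ K)"
  proof -
    have "(\<Sum>n<L. if n < K then m else 0) = real (card ({..<L} \<inter> {n. n < K})) * m"
      by (simp add: sum.If_cases)
    also have "\<dots> \<le> real K * (D * x ^ K)"
    proof (intro mult_mono measure_le)
      have "card ({..<L} \<inter> {n. n < K}) \<le> card {..<K}"
        by (intro card_mono) auto
      then show "real (card ({..<L} \<inter> {n. n < K})) \<le> real K" by simp
    qed auto
    finally show ?thesis by (simp add: mult.left_commute)
  qed
  moreover have "D * (\<Sum>n<L. if n < K then 0 else x ^ Suc n) \<le> D * (x ^ K / (1 - x))"
    using geometric_tail_sum_le[of x] x D by (intro mult_left_mono) auto
  ultimately show ?thesis
    unfolding gap_error_def by simp
qed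

lemma gap_error_nonneg: "0 \<le> gap_error D x K"
  using D x by (simp add: gap_error_def)

text \<open>Summing over the gap \<open>Suc n\<close> to the second visit leaves
  \<open>L - Suc n\<close> time steps, which the reindexing turns into \<open>l\<close>. The uniform
  bound \<open>X\<close> lets the gap errors be summed separately.\<close>

lemma G_Suc_bound:
  assumes "\<And>l. l < L \<Longrightarrow> G q l \<le> X" "0 \<le> X"
  shows "\<bar>G (Suc q) L - m * (\<Sum>l<L. G q l)\<bar> \<le> gap_error D x K * X"
proof -
  let ?I = "\<lambda>n. \<integral>z. indicator A z * mark q (L - Suc n) ((T ^^ Suc n) z) \<partial>M"
  let ?e = "\<lambda>n. if Suc n \<le> K then m else D * x ^ Suc n"
  have "G (Suc q) L = (\<integral>z. (\<Sum>n<L. indicator A z * mark q (L - Suc n) ((T ^^ Suc n) z)) \<partial>M)"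
    by (simp only: G_def mark_def visits_choose_Suc sum_distrib_left)
  also have "\<dots> = (\<Sum>n<L. ?I n)"
    by (intro Bochner_Integration.integral_sum integrable_indicator_mark)
  finally have "\<bar>G (Suc q) L - m * (\<Sum>l<L. G q l)\<bar> = \<bar>\<Sum>n<L. ?I n - m * G q (L - Suc n)\<bar>"
    by (simp only: sum.nat_diff_reindex[of "G q" L, symmetric] sum_subtractf sum_distrib_left)
  also have "\<dots> \<le> (\<Sum>n<L. \<bar>?I n - m * G q (L - Suc n)\<bar>)"
    by (rule sum_abs)
  also have "\<dots> \<le> (\<Sum>n<L. ?e n * X)"
  proof (rule sum_mono)
    fix n assume n: "n \<in> {..<L}"
    have "\<bar>?I n - m * G q (L - Suc n)\<bar> \<le> ?e n * G q (L - Suc n)"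
      by (rule mixing_mark) simp
    also have "\<dots> \<le> ?e n * X"
      using n D x by (intro mult_left_mono assms(1)) auto
    finally show "\<bar>?I n - m * G q (L - Suc n)\<bar> \<le> ?e n * X" .
  qed
  also have "\<dots> = (\<Sum>n<L. ?e n) * X"
    by (rule sum_distrib_right[symmetric])
  also have "\<dots> \<le> gap_error D x K * X"
    by (intro mult_right_mono sum_gap_errors_le assms(2))
  finally show ?thesis .
qed

lemma power_choose_le:
  assumes "real L * m \<le> t"
  shows "m ^ q * real (L choose q) \<le> t ^ q"
proof -
  have "L choose q \<le> L ^ q"
    by (cases "q \<le> L") (auto simp: binomial_le_pow binomial_eq_0)
  then have "m ^ q * real (L choose q) \<le> m ^ q * real L ^ q"
    by (intro mult_left_mono) (simp_all flip: of_nat_power)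
  also have "\<dots> = (real L * m) ^ q"
    by (simp add: power_mult_distrib mult.commute)
  also have "\<dots> \<le> t ^ q"
    by (intro power_mono assms) simp
  finally show ?thesis .
qed

lemma sum_G_bound:
  assumes "\<And>l. l < L \<Longrightarrow> \<bar>G q l - m ^ Suc q * real (l choose q)\<bar> \<le> \<delta>"
  shows "\<bar>(\<Sum>l<L. G q l) - m ^ Suc q * real (L choose Suc q)\<bar> \<le> real L * \<delta>"
proof -
  have "(\<Sum>l<L. G q l) - m ^ Suc q * real (L choose Suc q)
      = (\<Sum>l<L. G q l - m ^ Suc q * real (l choose q))"
    by (simp only: sum_choose_lessThan[symmetric] sum_subtractf sum_distrib_left)
  also have "\<bar>\<dots>\<bar> \<le> (\<Sum>l<L. \<delta>)"
    by (rule order_trans[OF sum_abs sum_mono]) (use assms in auto)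
  finally show ?thesis by simp
qed

text \<open>The factor \<open>m\<close> in the error is what makes the induction work: summing over
  \<open>l < L\<close> costs a factor \<open>L\<close>, and multiplying by the new visit's
  \<open>m\<close> leaves \<open>L * m <= t\<close>.\<close>

lemma G_approx:
  fixes t :: real
  assumes "real L * m \<le> t" "gap_error D x K \<le> 1"
  shows "\<bar>G q L - m ^ Suc q * real (L choose q)\<bar> \<le> m * gap_error D x K * real q * (t + 1) ^ q"
  using assms(1)
proof (induction q arbitrary: L)
  case 0
  then show ?case
    by (simp add: G_def mark_def)
next
  case (Suc q)
  let ?E = "gap_error D x K"
  let ?d = "m * ?E * real q * (t + 1) ^ q"
  have t: "0 \<le> t"
    using Suc.prems by (meson measure_nonneg mult_nonneg_nonneg of_nat_0_le_iff order_trans)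
  have d: "0 \<le> ?d"
    using t gap_error_nonneg by simp
  have le: "real l * m \<le> t" if "l < L" for l
    using that Suc.prems by (meson less_imp_le measure_nonneg mult_right_mono of_nat_le_iff order_trans)
  have IH: "\<bar>G q l - m ^ Suc q * real (l choose q)\<bar> \<le> ?d" if "l < L" for l
    by (rule Suc.IH[OF le[OF that]])
  have G: "G q l \<le> ?d + m * t ^ q" if "l < L" for l
  proof -
    have "m ^ Suc q * real (l choose q) \<le> m * t ^ q"
      using mult_left_mono[OF power_choose_le[OF le[OF that], of q], of m] by (simp add: mult.assoc)
    then show ?thesis
      using IH[OF that] by linarith
  qed
  have "\<bar>G (Suc q) L - m * (\<Sum>l<L. G q l)\<bar> \<le> ?E * (?d + m * t ^ q)"
    by (rule G_Suc_bound) (rule G, use d t in auto)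
  moreover have "\<bar>m * (\<Sum>l<L. G q l) - m ^ Suc (Suc q) * real (L choose Suc q)\<bar> \<le> t * ?d"
  proof -
    have "m * (\<Sum>l<L. G q l) - m ^ Suc (Suc q) * real (L choose Suc q)
        = m * ((\<Sum>l<L. G q l) - m ^ Suc q * real (L choose Suc q))"
      by (simp add: right_diff_distrib)
    also have "\<bar>\<dots>\<bar> \<le> m * (real L * ?d)"
    proof -
      have "\<bar>(\<Sum>l<L. G q l) - m ^ Suc q * real (L choose Suc q)\<bar> \<le> real L * ?d"
        by (rule sum_G_bound) (rule IH)
      then show ?thesis
        unfolding abs_mult abs_of_nonneg[OF measure_nonneg]
        by (rule mult_left_mono) simp
    qed
    also have "\<dots> = (real L * m) * ?d" by simp
    also have "\<dots> \<le> t * ?d"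
      by (rule mult_right_mono[OF Suc.prems d])
    finally show ?thesis .
  qed
  ultimately have "\<bar>G (Suc q) L - m ^ Suc (Suc q) * real (L choose Suc q)\<bar>
      \<le> ?E * ?d + ?E * (m * t ^ q) + t * ?d"
    by (simp only: distrib_left)
  \<comment> \<open>The old error grows by at most the factor \<open>1 + t\<close>, since the gap
    error is at most 1; the new error contributes one more unit to the factor
    \<open>q\<close>.\<close>
  also have "\<dots> \<le> 1 * ?d + ?E * (m * (t + 1) ^ Suc q) + t * ?d"
  proof (intro add_mono mult_right_mono mult_left_mono)
    have "t ^ q \<le> (t + 1) ^ q"
      using t by (intro power_mono) auto
    also have "\<dots> \<le> (t + 1) ^ Suc q"
      using t by (intro power_increasing) auto
    finally show "t ^ q \<le> (t + 1) ^ Suc q" .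
  qed (use d assms(2) gap_error_nonneg in auto)
  also have "\<dots> = m * ?E * real (Suc q) * (t + 1) ^ Suc q"
    by (simp add: algebra_simps)
  finally show ?case .
qed

text \<open>By invariance the time of the first visit does not matter, only the time left after
  it.\<close>

lemma B_Suc: "B (Suc q) L = (\<Sum>l<L. G q l)"
proof -
  have "B (Suc q) L = (\<integral>z. (\<Sum>n<L. mark q (L - Suc n) ((T ^^ Suc n) z)) \<partial>M)"
    by (simp only: mark_def visits_choose_Suc)
  also have "\<dots> = (\<Sum>n<L. \<integral>z. mark q (L - Suc n) ((T ^^ Suc n) z) \<partial>M)"
    by (intro Bochner_Integration.integral_sum integrable_mark_funpow)
  also have "\<dots> = (\<Sum>n<L. G q (L - Suc n))"
    by (simp only: integral_funpow[OF measurable_mark] G_def)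
  finally show ?thesis
    by (simp only: sum.nat_diff_reindex)
qed

lemma B_approx:
  fixes t :: real
  assumes "real N * m \<le> t" "gap_error D x K \<le> 1"
  shows "\<bar>B q N - m ^ q * real (N choose q)\<bar> \<le> gap_error D x K * (real q * (t + 1) ^ Suc q)"
proof (cases q)
  case 0
  then show ?thesis
    by (simp add: prob_space)
next
  case (Suc q')
  let ?E = "gap_error D x K"
  let ?d = "m * ?E * real q' * (t + 1) ^ q'"
  have t: "0 \<le> t"
    using assms(1) by (meson measure_nonneg mult_nonneg_nonneg of_nat_0_le_iff order_trans)
  have le: "real l * m \<le> t" if "l < N" for l
    using that assms(1) by (meson less_imp_le measure_nonneg mult_right_mono of_nat_le_iff order_trans)
  have "\<bar>B q N - m ^ q * real (N choose q)\<bar> \<le> real N * ?d"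
    unfolding Suc B_Suc by (intro sum_G_bound G_approx le assms(2))
  also have "\<dots> = (real N * m) * (?E * (real q' * (t + 1) ^ q'))" by simp
  \<comment> \<open>The \<open>N\<close> summands are paid for by the factor \<open>m\<close> of
    \<open>?d\<close>; the rest is rounded up to a bound that also covers
    \<open>q = 0\<close>.\<close>
  also have "\<dots> \<le> (t + 1) * (?E * (real q * (t + 1) ^ q))"
    using t Suc gap_error_nonneg assms(1)
    by (intro mult_mono power_increasing) auto
  also have "\<dots> = ?E * (real q * (t + 1) ^ Suc q)" by simp
  finally show ?thesis .
qed

text \<open>The pointwise Bonferroni inequality, integrated.\<close>

lemma prob_visits_bound:
  "\<bar>measure M {z \<in> space M. p = visits T A N z}
      - (\<Sum>i\<le>k. (-1) ^ i * real ((p + i) choose p) * B (p + i) N)\<bar>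
    \<le> real ((p + Suc k) choose p) * B (p + Suc k) N"
proof -
  let ?V = "\<lambda>q z. real (visits T A N z choose q)"
  let ?s = "\<lambda>z. \<Sum>i\<le>k. (-1) ^ i * real ((p + i) choose p) * ?V (p + i) z"
  let ?W = "{z \<in> space M. p = visits T A N z}"
  have W [measurable]: "?W \<in> sets M"
    by measurable
  have int_s: "integrable M ?s"
    by (intro Bochner_Integration.integrable_sum integrable_mult_right integrable_visits_choose)
  have int_W: "integrable M (indicat_real ?W)"
    by (simp add: integrable_indicator_iff emeasure_eq_measure)
  have "(\<integral>z. ?s z \<partial>M) = (\<Sum>i\<le>k. (-1) ^ i * real ((p + i) choose p) * B (p + i) N)"
    by (subst Bochner_Integration.integral_sum)
      (auto intro!: integrable_mult_right integrable_visits_choose)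
  then have eq: "measure M ?W - (\<Sum>i\<le>k. (-1) ^ i * real ((p + i) choose p) * B (p + i) N)
      = (\<integral>z. indicator ?W z - ?s z \<partial>M)"
    using int_s int_W by simp
  have "\<bar>\<integral>z. indicator ?W z - ?s z \<partial>M\<bar> \<le> (\<integral>z. \<bar>indicator ?W z - ?s z\<bar> \<partial>M)"
    by (rule integral_abs_bound)
  also have "\<dots> \<le> (\<integral>z. real ((p + Suc k) choose p) * ?V (p + Suc k) z \<partial>M)"
  proof (rule integral_mono)
    fix z assume z: "z \<in> space M"
    have W_eq: "indicat_real ?W z = of_bool (visits T A N z = p)"
      using z unfolding indicator_def by auto
    show "\<bar>indicator ?W z - ?s z\<bar> \<le> real ((p + Suc k) choose p) * ?V (p + Suc k) z"
      unfolding W_eq by (rule binomial_inversion_bound)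
  qed (intro integrable_abs Bochner_Integration.integrable_diff int_s int_W
      integrable_mult_right integrable_visits_choose)+
  also have "\<dots> = real ((p + Suc k) choose p) * B (p + Suc k) N"
    by simp
  finally show ?thesis unfolding eq .
qed

end

section \<open>The limit along shrinking balls\<close>

theorem theorem4:
  fixes T :: "real \<Rightarrow> real" and M :: "real measure" and y c1 r0 t :: real and p :: nat
  assumes "prob_space M"
    and "sets M = sets (restrict_space borel {0..1})"
    and "T \<in> measurable M M"
    and "distr M M T = M"
    and "exp_mixing_BV_L1 M T"
    and "y \<in> measure_support M"
    and "c1 > 0" and "r0 > 0"
    and "\<And>(k::nat) r. \<lbrakk>0 < r; r < r0; 1 \<le> k; real k \<le> - c1 * ln r\<rbrakk>
           \<Longrightarrow> unit_ball y r \<inter> (T ^^ k) ` unit_ball y r = {}"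
    and "t > 0"
  shows "((\<lambda>r. measure M {x \<in> space M.
              p = card {j::nat. 1 \<le> j \<and> real j \<le> t / measure M (unit_ball y r)
                                \<and> (T ^^ j) x \<in> unit_ball y r}})
           \<longlongrightarrow> t ^ p * exp (- t) / fact p) (at_right 0)"
proof -
  interpret prob_space M by fact
  let ?A = "unit_ball y"
  have space: "space M = {0..1}"
    using sets_eq_imp_space_eq[OF assms(2)] by simp
  have A: "?A r \<in> sets M" for r
    unfolding assms(2) sets_restrict_space unit_ball_def by auto
  have pos: "0 < measure M (?A r)" if "0 < r" for r
  proof -
    have "y \<in> ball y r"
      using that by simp
    then have "emeasure M (ball y r \<inter> space M) > 0"
      using assms(6) unfolding measure_support_def by blast
    then show ?thesis
      by (simp add: space unit_ball_def emeasure_eq_measure)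
  qed
  obtain \<tau> C where \<tau>: "\<tau> > 0" and C: "C > 0"
    and mix: "\<And>n f g. integrable M f \<Longrightarrow> bv_norm g < \<infinity> \<Longrightarrow>
      \<bar>(\<integral>x. f ((T ^^ n) x) * g x \<partial>M) - (\<integral>x. f x \<partial>M) * (\<integral>x. g x \<partial>M)\<bar>
        \<le> C * exp (- \<tau> * real n) * (\<integral>x. \<bar>f x\<bar> \<partial>M) * enn2real (bv_norm g)"
    using assms(5) unfolding exp_mixing_BV_L1_def by blast
  \<comment> \<open>The 3 bounds the variation norm of the indicator of any ball, so
    \<open>D\<close> and \<open>x\<close> do not depend on \<open>r\<close>.\<close>
  define D x where "D = C * 3" and "x = exp (- \<tau>)"
  have x: "0 < x" "x < 1" and D: "0 \<le> D"
    using \<tau> C by (auto simp: x_def D_def)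
  have mixing: "\<bar>(\<integral>z. indicator (?A r) z * f ((T ^^ n) z) \<partial>M) - measure M (?A r) * (\<integral>z. f z \<partial>M)\<bar>
      \<le> D * x ^ n * (\<integral>z. \<bar>f z\<bar> \<partial>M)" if f: "integrable M f" for r n f
  proof -
    let ?g = "indicat_real (?A r)"
    have "bv_norm ?g \<le> ennreal 3"
      using bv_norm_indicator_unit_ball[of y r] by simp
    then have g: "bv_norm ?g < \<infinity>" "enn2real (bv_norm ?g) \<le> 3"
      by (auto intro: enn2real_leI le_less_trans)
    have "\<bar>(\<integral>z. f ((T ^^ n) z) * ?g z \<partial>M) - (\<integral>z. f z \<partial>M) * (\<integral>z. ?g z \<partial>M)\<bar>
        \<le> C * exp (- \<tau> * real n) * (\<integral>z. \<bar>f z\<bar> \<partial>M) * enn2real (bv_norm ?g)"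
      by (rule mix[OF f g(1)])
    also have "\<dots> \<le> C * exp (- \<tau> * real n) * (\<integral>z. \<bar>f z\<bar> \<partial>M) * 3"
      using C g(2) by (intro mult_left_mono mult_nonneg_nonneg integral_nonneg_AE) auto
    also have "\<dots> = D * x ^ n * (\<integral>z. \<bar>f z\<bar> \<partial>M)"
      by (simp add: D_def x_def exp_of_nat_mult[symmetric] mult.commute)
    finally show ?thesis
      using A[of r] sets.sets_into_space[OF A[of r]] by (simp add: mult.commute Int_absorb2)
  qed
  \<comment> \<open>The range of times without returns; it tends to infinity as \<open>r\<close>
    tends to 0.\<close>
  define K where "K r = nat \<lfloor>- c1 * ln r\<rfloor>" for r
  define m N where "m r = measure M (?A r)" and "N r = nat \<lfloor>t / m r\<rfloor>" for r
  have right: "\<forall>\<^sub>F r in at_right 0. (0::real) < r" "\<forall>\<^sub>F r in at_right 0. r < r0"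
    using assms(8) by (auto simp: eventually_at_right_less eventually_at_right_field)
  have "filterlim (\<lambda>r. - c1 * ln r) at_top (at_right 0)"
  proof -
    have "filterlim (\<lambda>r::real. - ln r) at_top (at_right 0)"
      using ln_at_0 by (simp add: filterlim_uminus_at_bot)
    then show ?thesis
      using filterlim_tendsto_pos_mult_at_top[OF tendsto_const assms(7)] by fastforce
  qed
  then have "filterlim (\<lambda>r. \<lfloor>- c1 * ln r\<rfloor>) at_top (at_right 0)"
    by (rule filterlim_compose[OF filterlim_floor_sequentially])
  then have K: "filterlim K at_top (at_right 0)"
    unfolding K_def by (rule filterlim_compose[OF filterlim_nat_sequentially])
  have E: "((\<lambda>r. gap_error D x (K r)) \<longlongrightarrow> 0) (at_right 0)"
    by (rule filterlim_compose[OF gap_error_tendsto_0[OF x] K])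
  have sparse: "\<forall>\<^sub>F r in at_right 0. sparse_returns M T (?A r) D x (K r)"
    using right eventually_compose_filterlim[OF eventually_ge_at_top[of 1] K]
  proof eventually_elim
    case (elim r)
    have "(T ^^ n) z \<notin> ?A r" if "z \<in> ?A r" "1 \<le> n" "n \<le> K r" for n z
    proof -
      \<comment> \<open>Here \<open>1 <= n\<close> rules out that \<open>K r\<close> is the default
        0 of \<open>nat\<close> at a negative floor.\<close>
      have "real n \<le> - c1 * ln r"
        using that(2,3) unfolding K_def by linarith
      then show ?thesis
        using assms(9)[of r n] elim that(1,2) by auto
    qed
    then show ?case
      using assms(3,4) A D x mixing elim pos by unfold_locales auto
  qed
  \<comment> \<open>Absence of short returns forces the measure of the balls to 0, through
    \<open>m <= D * x^K\<close>.\<close>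
  have m0: "(m \<longlongrightarrow> 0) (at_right 0)"
  proof (rule tendsto_sandwich[where f = "\<lambda>_. 0" and h = "\<lambda>r. D * x ^ K r"])
    have "(\<lambda>n. D * x ^ n) \<longlonglongrightarrow> D * 0"
      using x by (intro tendsto_intros LIMSEQ_power_zero) auto
    then show "((\<lambda>r. D * x ^ K r) \<longlongrightarrow> 0) (at_right 0)"
      using filterlim_compose[OF _ K] by fastforce
    show "\<forall>\<^sub>F r in at_right 0. m r \<le> D * x ^ K r"
      using sparse by eventually_elim (simp add: m_def sparse_returns.measure_le)
  qed (simp_all add: m_def)
  have N: "real (N r) * m r \<le> t" "t - m r \<le> real (N r) * m r" if "0 < r" for r
  proof -
    have m: "0 < m r"
      using pos[OF that] by (simp add: m_def)
    have "real (N r) \<le> t / m r" "t / m r - 1 \<le> real (N r)"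
      using m assms(10) by (auto simp: N_def)
    with m show "real (N r) * m r \<le> t" "t - m r \<le> real (N r) * m r"
      by (auto simp: field_simps)
  qed
  have Nm: "((\<lambda>r. real (N r) * m r) \<longlongrightarrow> t) (at_right 0)"
  proof (rule tendsto_sandwich[where f = "\<lambda>r. t - m r" and h = "\<lambda>_. t"])
    show "((\<lambda>r. t - m r) \<longlongrightarrow> t) (at_right 0)"
      using tendsto_diff[OF tendsto_const m0, of t] by simp
    show "\<forall>\<^sub>F r in at_right 0. t - m r \<le> real (N r) * m r"
      "\<forall>\<^sub>F r in at_right 0. real (N r) * m r \<le> t"
      using right(1) by (eventually_elim, use N in blast)+
  qed simp
  define B where "B q r = (\<integral>z. real (visits T (?A r) (N r) z choose q) \<partial>M)" for q r
  have B: "((B q) \<longlongrightarrow> t ^ q / fact q) (at_right 0)" for q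
  proof -
    let ?c = "real q * (t + 1) ^ Suc q"
    \<comment> \<open>The moments are compared with those of a binomial law with \<open>N r\<close>
      trials and success probability \<open>m r\<close>; the gap error tends to 0.\<close>
    have "((\<lambda>r. B q r - m r ^ q * real (N r choose q)) \<longlongrightarrow> 0) (at_right 0)"
    proof (rule Lim_null_comparison)
      have "\<forall>\<^sub>F r in at_right 0. gap_error D x (K r) \<le> 1"
        using order_tendstoD(2)[OF E, of 1] by (auto elim: eventually_mono)
      with sparse right(1)
      show "\<forall>\<^sub>F r in at_right 0. norm (B q r - m r ^ q * real (N r choose q))
          \<le> gap_error D x (K r) * ?c"
      proof eventually_elim
        case (elim r)
        then show ?case
          using sparse_returns.B_approx[of M T "?A r" D x "K r" "N r" t q] N(1)[of r]
          by (simp only: B_def m_def real_norm_def)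
      qed
      show "((\<lambda>r. gap_error D x (K r) * ?c) \<longlongrightarrow> 0) (at_right 0)"
        using tendsto_mult_right[OF E, of ?c] by simp
    qed
    then show ?thesis
      using tendsto_add[OF _ binomial_moment_limit[OF m0 Nm, of q]] by fastforce
  qed
  have "((\<lambda>r. measure M {z \<in> space M. p = visits T (?A r) (N r) z})
      \<longlongrightarrow> t ^ p * exp (- t) / fact p) (at_right 0)"
  proof (rule poisson_limit_of_binomial_moments[OF B])
    show "\<forall>\<^sub>F r in at_right 0. \<bar>measure M {z \<in> space M. p = visits T (?A r) (N r) z}
        - (\<Sum>i\<le>k. (-1) ^ i * real ((p + i) choose p) * B (p + i) r)\<bar>
        \<le> real ((p + Suc k) choose p) * B (p + Suc k) r" for k
      using sparse unfolding B_def by eventually_elim (rule sparse_returns.prob_visits_bound)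
  qed
  moreover have "\<forall>\<^sub>F r in at_right 0. measure M {z \<in> space M. p = visits T (?A r) (N r) z}
      = measure M {x \<in> space M. p = card {j::nat. 1 \<le> j \<and> real j \<le> t / measure M (?A r)
                                \<and> (T ^^ j) x \<in> ?A r}}"
    using right(1)
  proof eventually_elim
    case (elim r)
    have "j \<le> N r \<longleftrightarrow> real j \<le> t / measure M (?A r)" for j
      using pos[OF elim] assms(10) by (simp add: N_def m_def le_nat_iff le_floor_iff)
    then show ?case
      by (simp only: visits_eq_card)
  qed
  ultimately show ?thesis
    by (rule Lim_transform_eventually)
qed

end
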